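(* Let $V$ be a real vector space, let $(j,F)$ be a free vector lattice over $V$, and let $V^\sharp$ be the vector space of all linear functionals $V\to\mathbb{R}$. Let $L^\sharp$ be a linear subspace of $V^\sharp$ that separates the points of $V$. Let $\mathrm{Fun}(L^\sharp)$ be the vector lattice of all real-valued functions on $L^\sharp$ (with pointwise operations and ordering), and define the linear map $\Psi:V\to\mathrm{Fun}(L^\sharp)$ by \[ [\Psi(v)](l^\sharp):=l^\sharp(v)\qquad (v\in V,\ l^\sharp\in L^\sharp). \] Let $\overline{\Psi}:F\to\mathrm{Fun}(L^\sharp)$ be the unique vector lattice homomorphism such that $\overline{\Psi}\circ j=\Psi$. Then $\overline{\Psi}$ is injective, and it establishes a vector lattice isomorphism between $F$ and the vector sublattice $\mathcal{F}$ of $\mathrm{Fun}(L^\sharp)$ that is generated by the linear subspace $\Psi(V)$ of $\mathrm{Fun}(L^\sharp)$. Consequently, $(\Psi,\mathcal{F})$ is a free vector lattice over $V$.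
   Context: All vector spaces and vector lattices are over $\mathbb{R}$; vector lattices are not assumed to be Archimedean. A free vector lattice over a real vector space $V$ is a pair $(j,F)$, where $F$ is a vector lattice and $j:V\to F$ is a linear map, such that for every vector lattice $G$ and every linear map $\varphi:V\to G$ there exists a unique vector lattice homomorphism $\overline{\varphi}:F\to G$ with $\overline{\varphi}\circ j=\varphi$. A set $L^\sharp$ of linear functionals on $V$ separates the points of $V$ if for every $v\in V$ with $v\neq 0$ there is $l^\sharp\in L^\sharp$ with $l^\sharp(v)\neq 0$. The vector sublattice generated by a subset of a vector lattice is the smallest vector sublattice containing that subset. *)

theory Defs
  imports Complex_Main "HOL-Library.Function_Algebras" "HOL-Library.FuncSet"
begin

text \<open>Vector lattices are not assumed to be Archimedean.\<close>

class vector_lattice = ordered_real_vector + lattice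

instance real :: vector_lattice ..

instantiation "fun" :: (type, real_vector) real_vector
begin

definition scaleR_fun :: "real \<Rightarrow> ('a \<Rightarrow> 'b) \<Rightarrow> 'a \<Rightarrow> 'b"
  where "scaleR_fun r f = (\<lambda>x. r *\<^sub>R f x)"

instance
  by standard (simp_all add: scaleR_fun_def fun_eq_iff scaleR_add_right scaleR_add_left)

end

instance "fun" :: (type, ordered_real_vector) ordered_real_vector
  by standard (auto simp: scaleR_fun_def le_fun_def intro: scaleR_left_mono scaleR_right_mono)

instance "fun" :: (type, vector_lattice) vector_lattice ..

definition vector_sublattice :: "'a::vector_lattice set \<Rightarrow> bool"
  where "vector_sublattice G \<longleftrightarrow>
    subspace G \<and> (\<forall>x\<in>G. \<forall>y\<in>G. sup x y \<in> G) \<and> (\<forall>x\<in>G. \<forall>y\<in>G. inf x y \<in> G)"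

text \<open>
  A vector lattice is represented by a vector sublattice \<open>G :: 'g set\<close> of a type of class
  \<^class>\<open>vector_lattice\<close>; taking \<open>G = UNIV\<close>, and \<open>'g\<close> arbitrary, one obtains all vector lattices.
  Homomorphisms are extensional functions, so that \<open>\<exists>!\<close> below means uniqueness as a map
  on \<open>F\<close>.
\<close>

definition vector_lattice_hom ::
    "'a::vector_lattice set \<Rightarrow> 'b::vector_lattice set \<Rightarrow> ('a \<Rightarrow> 'b) \<Rightarrow> bool"
  where "vector_lattice_hom F G h \<longleftrightarrow>
    h \<in> F \<rightarrow>\<^sub>E G \<and>
    (\<forall>x\<in>F. \<forall>y\<in>F. h (x + y) = h x + h y) \<and>
    (\<forall>r. \<forall>x\<in>F. h (r *\<^sub>R x) = r *\<^sub>R h x) \<and>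
    (\<forall>x\<in>F. \<forall>y\<in>F. h (sup x y) = sup (h x) (h y)) \<and>
    (\<forall>x\<in>F. \<forall>y\<in>F. h (inf x y) = inf (h x) (h y))"

definition vector_lattice_iso ::
    "'a::vector_lattice set \<Rightarrow> 'b::vector_lattice set \<Rightarrow> ('a \<Rightarrow> 'b) \<Rightarrow> bool"
  where "vector_lattice_iso F G h \<longleftrightarrow> vector_lattice_hom F G h \<and> bij_betw h F G"

text \<open>
  \<open>free_vector_lattice TYPE('g) j F\<close> is the universal property with respect to all vector lattices
  \<open>G\<close> inside the type \<open>'g\<close>. As HOL cannot quantify over types within a formula, freeness in the
  usual sense is this predicate for every \<open>'g\<close>: a conclusion should have \<open>'g\<close> as a free
  type variable, whereas a hypothesis at particular instances of \<open>'g\<close> is a weaker assumption than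
  freeness in the usual sense.
\<close>

definition free_vector_lattice ::
    "'g::vector_lattice itself \<Rightarrow> ('v::real_vector \<Rightarrow> 'f::vector_lattice) \<Rightarrow> 'f set \<Rightarrow> bool"
  where "free_vector_lattice _ j F \<longleftrightarrow>
    vector_sublattice F \<and> linear j \<and> range j \<subseteq> F \<and>
    (\<forall>(G :: 'g set) \<phi>. vector_sublattice G \<and> linear \<phi> \<and> range \<phi> \<subseteq> G \<longrightarrow>
      (\<exists>!h. vector_lattice_hom F G h \<and> h \<circ> j = \<phi>))"

definition hom_extension ::
    "('v::real_vector \<Rightarrow> 'f::vector_lattice) \<Rightarrow> 'f set \<Rightarrow> 'g::vector_lattice set \<Rightarrow>
      ('v \<Rightarrow> 'g) \<Rightarrow> 'f \<Rightarrow> 'g"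
  where "hom_extension j F G \<phi> = (THE h. vector_lattice_hom F G h \<and> h \<circ> j = \<phi>)"

definition algebraic_dual :: "('v::real_vector \<Rightarrow> real) set"
  where "algebraic_dual = {l. linear l}"

definition separates_points :: "('v::real_vector \<Rightarrow> real) set \<Rightarrow> bool"
  where "separates_points L \<longleftrightarrow> (\<forall>v. v \<noteq> 0 \<longrightarrow> (\<exists>l\<in>L. l v \<noteq> 0))"

text \<open>
  A real-valued function on a set \<open>X\<close> is represented by its extension by \<open>0\<close> (rather than by
  \<open>undefined\<close>), so that the functions on \<open>X\<close> form a vector sublattice of the full function type
  and the pointwise operations on \<open>X\<close> are those of the type.
\<close>

definition Fun_on :: "'x set \<Rightarrow> ('x \<Rightarrow> real) set"
  where "Fun_on X = {f. \<forall>x. x \<notin> X \<longrightarrow> f x = 0}"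

definition evaluation :: "('v \<Rightarrow> real) set \<Rightarrow> 'v \<Rightarrow> ('v \<Rightarrow> real) \<Rightarrow> real"
  where "evaluation L v = (\<lambda>l. if l \<in> L then l v else 0)"

definition generated_vector_sublattice :: "'a::vector_lattice set \<Rightarrow> 'a set"
  where "generated_vector_sublattice S = vector_sublattice hull S"

end

theory Submission
  imports Defs
begin

text \<open>
  Every element of the vector sublattice generated by \<open>\<Psi>(V)\<close> is the value of a lattice term in
  elements of \<open>V\<close>, because addition and scalar multiplication can be pushed down to the leaves of
  such a term. So freeness amounts to the claim that a term whose value is \<open>\<le> 0\<close> at every
  functional in \<open>L\<close> has a value \<open>\<le> 0\<close> in every vector lattice. Since vector lattices are
  distributive, this reduces to infima of finitely many \<open>u\<^sub>1, \<dots>, u\<^sub>n \<in> V\<close>. If no \<open>l \<in> L\<close> is positive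
  at all \<open>u\<^sub>i\<close>, then Gordan's theorem of the alternative yields a nontrivial combination
  \<open>\<Sum> c\<^sub>i l(u\<^sub>i) = 0\<close> with \<open>c\<^sub>i \<ge> 0\<close>, and \<open>\<Sum> c\<^sub>i u\<^sub>i = 0\<close> because \<open>L\<close> separates points; hence a lower bound
  \<open>x\<close> of the images of the \<open>u\<^sub>i\<close> satisfies \<open>(\<Sum> c\<^sub>i) x \<le> 0\<close>. The isomorphism with \<open>F\<close> is then
  the uniqueness of free objects.
\<close>

section \<open>Gordan's theorem of the alternative\<close>

text \<open>Induction on \<open>U\<close> with \<open>L\<close> generalised, because the hypothesis
  is applied both to \<open>L\<close> and to the kernel \<open>?K\<close> of evaluation at the new
  point \<open>w\<close>. A member of \<open>?K\<close> positive on \<open>U\<close> is perturbed so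
  as to become positive at \<open>w\<close>; a dependence on \<open>?K\<close> is completed by a
  coefficient at \<open>w\<close>, unless that coefficient would be negative.\<close>

lemma gordan_alternative:
  fixes L :: "('i \<Rightarrow> real) set"
  assumes "finite U" and "subspace L"
  shows "(\<exists>l\<in>L. \<forall>u\<in>U. 0 < l u) \<or>
    (\<exists>c. (\<forall>u\<in>U. 0 \<le> c u) \<and> (\<exists>u\<in>U. 0 < c u) \<and> (\<forall>l\<in>L. (\<Sum>u\<in>U. c u * l u) = 0))"
  using assms
proof (induction U arbitrary: L rule: finite_induct)
  case empty
  then show ?case using subspace_0 by auto
next
  case (insert w U)
  have extend: ?case
    if "\<forall>u\<in>U. 0 \<le> c u" "b \<ge> 0" "b > 0 \<or> (\<exists>u\<in>U. 0 < c u)"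
      "\<forall>l\<in>L. (\<Sum>u\<in>U. c u * l u) + b * l w = 0" for c :: "'i \<Rightarrow> real" and b
  proof (intro disjI2 exI conjI)
    have ne: "u \<noteq> w" if "u \<in> U" for u
      using that insert.hyps by auto
    show "\<forall>u\<in>insert w U. 0 \<le> (c(w := b)) u" "\<exists>u\<in>insert w U. 0 < (c(w := b)) u"
      using that ne by auto
    have "(\<Sum>u\<in>insert w U. (c(w := b)) u * l u) = (\<Sum>u\<in>U. c u * l u) + b * l w" for l
      using insert.hyps ne by (simp add: add.commute cong: sum.cong)
    then show "\<forall>l\<in>L. (\<Sum>u\<in>insert w U. (c(w := b)) u * l u) = 0"
      using that(4) by simp
  qed
  have comb: "(\<lambda>x. a * l x + b * m x) \<in> L" if "l \<in> L" "m \<in> L" for l m a b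
  proof -
    have "a *\<^sub>R l + b *\<^sub>R m \<in> L"
      using that insert.prems by (simp add: subspace_add subspace_scale)
    then show ?thesis by (simp add: scaleR_fun_def plus_fun_def)
  qed
  let ?K = "{l \<in> L. l w = 0}"
  have K: "subspace ?K"
    using insert.prems unfolding subspace_def by (auto simp: scaleR_fun_def)
  consider (all) "\<forall>l\<in>L. l w = 0" | (dependent) c where "\<forall>u\<in>U. 0 \<le> c u" "\<exists>u\<in>U. 0 < c u"
      "\<forall>l\<in>L. (\<Sum>u\<in>U. c u * l u) = 0"
    | (kernel) m0 l where "m0 \<in> L" "m0 w \<noteq> 0" "l \<in> ?K" "\<forall>u\<in>U. 0 < l u"
    | (mixed) m0 l0 c where "m0 \<in> L" "m0 w \<noteq> 0" "l0 \<in> L" "\<forall>u\<in>U. 0 < l0 u"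
      "\<forall>u\<in>U. 0 \<le> c u" "\<exists>u\<in>U. 0 < c u" "\<forall>l\<in>?K. (\<Sum>u\<in>U. c u * l u) = 0"
    using insert.IH[OF insert.prems] insert.IH[OF K] by blast
  then show ?case
  proof cases
    case all
    then show ?thesis using extend[of "\<lambda>_. 0" 1] by simp
  next
    case dependent
    then show ?thesis using extend[of c 0] by simp
  next
    case kernel
    define m where "m = (\<lambda>x. sgn (m0 w) * m0 x)"
    have m: "m \<in> L" "0 < m w"
      using comb[OF kernel(1,1), of "sgn (m0 w)" 0] kernel(2)
      by (auto simp: m_def sgn_real_def)
    \<comment> \<open>As \<open>l w = 0\<close>, every \<open>e > 0\<close> makes
      \<open>l + e * m\<close> positive at \<open>w\<close>; a small \<open>e\<close> preserves the
      finitely many strict inequalities on \<open>U\<close>.\<close>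
    have "\<exists>e>0. \<forall>u\<in>U. 0 < l u + e * m u"
    proof -
      have "\<forall>\<^sub>F e in at_right 0. \<forall>u\<in>U. 0 < l u + e * m u"
      proof (intro eventually_ball_finite insert.hyps ballI)
        fix u assume "u \<in> U"
        have "((\<lambda>e. l u + e * m u) \<longlongrightarrow> l u + 0 * m u) (at_right 0)"
          by (intro tendsto_intros)
        then show "\<forall>\<^sub>F e in at_right 0. 0 < l u + e * m u"
          using kernel(4) \<open>u \<in> U\<close> by (auto intro: order_tendstoD)
      qed
      then have "\<forall>\<^sub>F e in at_right 0. 0 < e \<and> (\<forall>u\<in>U. 0 < l u + e * m u)"
        by (intro eventually_conj eventually_at_right_less)
      then show ?thesis
        using eventually_happens'[OF trivial_limit_at_right_real] by blast
    qed
    then obtain e where e: "e > 0" "\<forall>u\<in>U. 0 < l u + e * m u" by blast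
    have "(\<lambda>x. 1 * l x + e * m x) \<in> L"
      using comb kernel(3) m(1) by blast
    moreover have "\<forall>u\<in>insert w U. 0 < 1 * l u + e * m u"
      using e m(2) kernel(3) by simp
    ultimately show ?thesis by (intro disjI1 bexI)
  next
    case mixed
    \<comment> \<open>The functional sending \<open>l\<close> to the weighted sum over
      \<open>U\<close> vanishes on \<open>?K\<close>, so on \<open>L\<close> it is a multiple of
      evaluation at \<open>w\<close>; \<open>m0\<close>, which is nonzero at \<open>w\<close>,
      determines the factor.\<close>
    define a where "a = (\<Sum>u\<in>U. c u * m0 u) / m0 w"
    have a: "(\<Sum>u\<in>U. c u * l u) = a * l w" if "l \<in> L" for l
    proof -
      have "(\<lambda>x. 1 * l x + (- l w / m0 w) * m0 x) \<in> ?K"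
        using comb[OF that mixed(1), of 1 "- l w / m0 w"] mixed(2) by simp
      then have "(\<Sum>u\<in>U. c u * (1 * l u + (- l w / m0 w) * m0 u)) = 0"
        by (rule bspec[OF mixed(7)])
      also have "(\<Sum>u\<in>U. c u * (1 * l u + (- l w / m0 w) * m0 u)) =
          (\<Sum>u\<in>U. c u * l u) + (- l w / m0 w) * (\<Sum>u\<in>U. c u * m0 u)"
        by (simp add: sum_distrib_left flip: sum.distrib) (simp add: algebra_simps)
      finally show ?thesis by (simp add: a_def)
    qed
    show ?thesis
    \<comment> \<open>If \<open>a\<close> is nonpositive, \<open>- a\<close> is an admissible
      coefficient at \<open>w\<close>. Otherwise the weighted sum of \<open>l0\<close>, which is
      positive, has the sign of \<open>l0 w\<close>, so \<open>l0\<close> itself is the positive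
      member sought.\<close>
    proof (cases "a \<le> 0")
      case True
      then show ?thesis using extend[of c "- a"] mixed a by simp
    next
      case False
      have "0 < (\<Sum>u\<in>U. c u * l0 u)"
        using mixed insert.hyps by (auto intro!: sum_pos2)
      then have "0 < l0 w"
        using a[OF mixed(3)] False by (simp add: zero_less_mult_iff)
      then show ?thesis using mixed(3,4) by auto
    qed
  qed
qed

section \<open>Identities in vector lattices\<close>

lemma
  fixes x y z :: "'a::vector_lattice"
  shows add_sup_left: "z + sup x y = sup (z + x) (z + y)"
    and add_inf_left: "z + inf x y = inf (z + x) (z + y)"
proof -
  have "sup x y \<le> sup (z + x) (z + y) - z"
    by (intro le_supI) (simp_all add: le_diff_eq add.commute)
  then have "z + sup x y \<le> sup (z + x) (z + y)"
    by (simp only: le_diff_eq add.commute)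
  then show "z + sup x y = sup (z + x) (z + y)"
    by (intro antisym) simp_all
  have "inf (z + x) (z + y) - z \<le> inf x y"
    by (intro le_infI) (simp_all add: diff_le_eq add.commute)
  then have "inf (z + x) (z + y) \<le> z + inf x y"
    by (simp only: diff_le_eq add.commute)
  then show "z + inf x y = inf (z + x) (z + y)"
    by (intro antisym) simp_all
qed

lemma
  fixes x y z :: "'a::vector_lattice"
  shows add_sup_right: "sup x y + z = sup (x + z) (y + z)"
    and add_inf_right: "inf x y + z = inf (x + z) (y + z)"
  by (simp_all add: add_sup_left add_inf_left add.commute[of _ z])

lemma
  fixes x y :: "'a::vector_lattice"
  shows minus_sup: "- sup x y = inf (- x) (- y)"
    and minus_inf: "- inf x y = sup (- x) (- y)"
proof -
  have "sup x y \<le> - inf (- x) (- y)" "- sup (- x) (- y) \<le> inf x y"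
    by (simp_all add: le_minus_iff[of x] le_minus_iff[of y] minus_le_iff[of _ x] minus_le_iff[of _ y])
  then have "inf (- x) (- y) \<le> - sup x y" "- inf x y \<le> sup (- x) (- y)"
    by (metis le_minus_iff, metis minus_le_iff)
  then show "- sup x y = inf (- x) (- y)" "- inf x y = sup (- x) (- y)"
    by (auto intro!: antisym)
qed

lemma
  fixes x y :: "'a::vector_lattice"
  assumes "0 \<le> r"
  shows scaleR_sup: "r *\<^sub>R sup x y = sup (r *\<^sub>R x) (r *\<^sub>R y)"
    and scaleR_inf: "r *\<^sub>R inf x y = inf (r *\<^sub>R x) (r *\<^sub>R y)"
proof -
  have "r *\<^sub>R sup x y = sup (r *\<^sub>R x) (r *\<^sub>R y) \<and> r *\<^sub>R inf x y = inf (r *\<^sub>R x) (r *\<^sub>R y)"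
  proof (cases "r = 0")
    case False
    then have r: "0 < r" using assms by simp
    have "sup x y \<le> sup (r *\<^sub>R x) (r *\<^sub>R y) /\<^sub>R r" "inf (r *\<^sub>R x) (r *\<^sub>R y) /\<^sub>R r \<le> inf x y"
      using r by (simp_all add: pos_le_divideR_eq pos_divideR_le_eq)
    then have "r *\<^sub>R sup x y \<le> sup (r *\<^sub>R x) (r *\<^sub>R y)"
        "inf (r *\<^sub>R x) (r *\<^sub>R y) \<le> r *\<^sub>R inf x y"
      using r by (simp_all only: pos_le_divideR_eq pos_divideR_le_eq)
    then show ?thesis
      using assms by (auto intro!: antisym scaleR_left_mono)
  qed simp
  then show "r *\<^sub>R sup x y = sup (r *\<^sub>R x) (r *\<^sub>R y)" "r *\<^sub>R inf x y = inf (r *\<^sub>R x) (r *\<^sub>R y)"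
    by simp_all
qed

lemma sup_plus_inf:
  fixes x y :: "'a::vector_lattice"
  shows "sup x y + inf x y = x + y"
proof -
  have "inf x y = (x + y) + inf (- y) (- x)"
    by (simp add: add_inf_left)
  also have "\<dots> = (x + y) - sup x y"
    by (simp add: minus_sup[symmetric] sup.commute)
  finally show ?thesis by simp
qed

text \<open>Distributivity in the form used below: \<open>x\<close> is the supremum of
  \<open>inf a x\<close> and \<open>inf b x\<close>. The proof bounds both \<open>a\<close> and
  \<open>b\<close> by \<open>sup a b - x\<close>, using that \<open>sup\<close> and
  \<open>inf\<close> of two elements add up to their sum.\<close>

lemma le_0_if_inf_le_0:
  fixes a b x :: "'a::vector_lattice"
  assumes "x \<le> sup a b" and "inf a x \<le> 0" and "inf b x \<le> 0"
  shows "x \<le> 0"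
proof -
  have bound: "c \<le> sup a b - x" if "inf c x \<le> 0" "c \<le> sup a b" for c
  proof -
    have "c + x = sup c x + inf c x" by (simp add: sup_plus_inf)
    also have "\<dots> \<le> sup a b + 0"
      using that assms(1) by (intro add_mono) auto
    finally show ?thesis by (simp add: le_diff_eq)
  qed
  have "sup a b \<le> sup a b - x"
    using bound[of a] bound[of b] assms by simp
  then show ?thesis by (simp add: le_diff_eq)
qed

section \<open>Lattice terms with vectors at the leaves\<close>

text \<open>The same term can be evaluated at one functional, at \<open>evaluation L\<close> and at
  a linear map into any vector lattice; freeness comes from comparing these values.\<close>

datatype 'v lattice_term =
  Var 'v
| Sup "'v lattice_term" "'v lattice_term"
| Inf "'v lattice_term" "'v lattice_term"

primrec eval_term :: "('v \<Rightarrow> 'a::lattice) \<Rightarrow> 'v lattice_term \<Rightarrow> 'a" where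
  "eval_term \<phi> (Var v) = \<phi> v"
| "eval_term \<phi> (Sup s t) = sup (eval_term \<phi> s) (eval_term \<phi> t)"
| "eval_term \<phi> (Inf s t) = inf (eval_term \<phi> s) (eval_term \<phi> t)"

lemma eval_term_apply: "eval_term \<phi> t x = eval_term (\<lambda>v. \<phi> v x) t"
  by (induction t) auto

text \<open>Translations distribute over \<open>sup\<close> and \<open>inf\<close>, so the sum is
  carried to the leaves of the left term and then, as a translation, to those of the right
  one.\<close>

primrec add_term :: "'v::plus lattice_term \<Rightarrow> 'v lattice_term \<Rightarrow> 'v lattice_term" where
  "add_term (Var v) t = map_lattice_term ((+) v) t"
| "add_term (Sup r s) t = Sup (add_term r t) (add_term s t)"
| "add_term (Inf r s) t = Inf (add_term r t) (add_term s t)"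

primrec minus_term :: "'v::uminus lattice_term \<Rightarrow> 'v lattice_term" where
  "minus_term (Var v) = Var (- v)"
| "minus_term (Sup s t) = Inf (minus_term s) (minus_term t)"
| "minus_term (Inf s t) = Sup (minus_term s) (minus_term t)"

text \<open>Only nonnegative scalars preserve the order; a negative one is split into a positive
  scaling and a negation, which exchanges \<open>Sup\<close> and \<open>Inf\<close>.\<close>

definition scale_term :: "real \<Rightarrow> 'v::real_vector lattice_term \<Rightarrow> 'v lattice_term" where
  "scale_term r t =
    (if 0 \<le> r then map_lattice_term ((*\<^sub>R) r) t else minus_term (map_lattice_term ((*\<^sub>R) (- r)) t))"

context
  fixes \<phi> :: "'v::real_vector \<Rightarrow> 'a::vector_lattice"
  assumes linear: "linear \<phi>"
begin

lemma eval_add_term: "eval_term \<phi> (add_term s t) = eval_term \<phi> s + eval_term \<phi> t"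
proof (induction s)
  case (Var v)
  show ?case
    by (induction t) (simp_all add: linear_add[OF linear] add_sup_left add_inf_left)
qed (simp_all add: add_sup_right add_inf_right)

lemma eval_minus_term: "eval_term \<phi> (minus_term t) = - eval_term \<phi> t"
  by (induction t) (simp_all add: linear_neg[OF linear] minus_sup minus_inf)

lemma eval_scale_term: "eval_term \<phi> (scale_term r t) = r *\<^sub>R eval_term \<phi> t"
proof -
  have "eval_term \<phi> (map_lattice_term ((*\<^sub>R) q) t) = q *\<^sub>R eval_term \<phi> t" if "0 \<le> q" for q
    using that by (induction t) (simp_all add: linear_scale[OF linear] scaleR_sup scaleR_inf)
  from this[of r] this[of "- r"] show ?thesis
    by (simp add: scale_term_def eval_minus_term)
qed

lemma vector_sublattice_range_eval_term: "vector_sublattice (range (eval_term \<phi>))"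
  unfolding vector_sublattice_def subspace_def
proof (intro conjI ballI allI)
  show "0 \<in> range (eval_term \<phi>)"
    using linear_0[OF linear] by (intro range_eqI[of _ _ "Var 0"]) simp
  fix x y assume "x \<in> range (eval_term \<phi>)" "y \<in> range (eval_term \<phi>)"
  then obtain s t where "x = eval_term \<phi> s" "y = eval_term \<phi> t" by blast
  then show "x + y \<in> range (eval_term \<phi>)" "sup x y \<in> range (eval_term \<phi>)"
      "inf x y \<in> range (eval_term \<phi>)"
    by (metis eval_add_term rangeI, metis eval_term.simps(2) rangeI,
        metis eval_term.simps(3) rangeI)
next
  fix c x assume "x \<in> range (eval_term \<phi>)"
  then show "c *\<^sub>R x \<in> range (eval_term \<phi>)"
    by (metis eval_scale_term imageE rangeI)
qed

lemma generated_vector_sublattice_range: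
  "generated_vector_sublattice (range \<phi>) = range (eval_term \<phi>)"
  unfolding generated_vector_sublattice_def
proof (intro hull_unique)
  show "range \<phi> \<subseteq> range (eval_term \<phi>)"
    by (metis eval_term.simps(1) image_subsetI rangeI)
  fix T assume T: "range \<phi> \<subseteq> T" "vector_sublattice T"
  have "eval_term \<phi> t \<in> T" for t
    using T by (induction t) (auto simp: vector_sublattice_def)
  then show "range (eval_term \<phi>) \<subseteq> T" by blast
qed (rule vector_sublattice_range_eval_term)

section \<open>Nonpositivity on \<open>L\<close> implies nonpositivity in every vector
  lattice\<close>

context
  fixes L :: "('v \<Rightarrow> real) set"
  assumes L_linear: "L \<subseteq> algebraic_dual"
    and L_subspace: "subspace L"
    and L_separates: "separates_points L"
begin

lemma lower_bound_le_0_linear: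
  assumes "finite U" and nonpos: "\<And>l. l \<in> L \<Longrightarrow> \<exists>u\<in>U. l u \<le> 0"
    and x: "\<And>u. u \<in> U \<Longrightarrow> x \<le> \<phi> u"
  shows "x \<le> 0"
proof -
  obtain c where c: "\<forall>u\<in>U. 0 \<le> c u" "\<exists>u\<in>U. 0 < c u"
    "\<forall>l\<in>L. (\<Sum>u\<in>U. c u * l u) = 0"
    using gordan_alternative[OF \<open>finite U\<close> L_subspace] nonpos by (metis not_le)
  \<comment> \<open>Separation of points turns a relation seen only by \<open>L\<close> into one in
    \<open>V\<close>, which the arbitrary linear map \<phi> then preserves.\<close>
  have "l (\<Sum>u\<in>U. c u *\<^sub>R u) = 0" if "l \<in> L" for l
  proof -
    have "linear l" using that L_linear by (auto simp: algebraic_dual_def)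
    then show ?thesis using c(3) that by (simp add: linear_sum linear_scale)
  qed
  then have "(\<Sum>u\<in>U. c u *\<^sub>R u) = 0"
    using L_separates unfolding separates_points_def by blast
  then have "(\<Sum>u\<in>U. c u *\<^sub>R \<phi> u) = 0"
    using linear linear_sum[OF linear, of "\<lambda>u. c u *\<^sub>R u" U]
    by (simp add: linear_scale linear_0)
  moreover have "(\<Sum>u\<in>U. c u) *\<^sub>R x \<le> (\<Sum>u\<in>U. c u *\<^sub>R \<phi> u)"
    unfolding scaleR_sum_left using c x by (intro sum_mono scaleR_left_mono) auto
  moreover have "0 < (\<Sum>u\<in>U. c u)"
    using c \<open>finite U\<close> by (auto intro!: sum_pos2)
  ultimately show ?thesis
    by (metis pos_le_divideR_eq scaleR_zero_right)
qed

text \<open>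
  The elements of \<open>U\<close> and the terms in \<open>ts\<close> are to be read as the arguments of one finite infimum,
  which is decomposed term by term.
\<close>

lemma lower_bound_le_0:
  assumes "finite U"
    and "\<And>l. l \<in> L \<Longrightarrow> (\<exists>u\<in>U. l u \<le> 0) \<or> (\<exists>t\<in>set ts. eval_term l t \<le> 0)"
    and "\<And>u. u \<in> U \<Longrightarrow> x \<le> \<phi> u" and "\<And>t. t \<in> set ts \<Longrightarrow> x \<le> eval_term \<phi> t"
  shows "x \<le> 0"
  using assms
\<comment> \<open>\<open>Suc\<close> makes moving a variable into \<open>U\<close> a decrease. The
  factor 2 makes replacing \<open>Inf a b\<close> by the two entries \<open>a\<close> and
  \<open>b\<close> a decrease, despite the additional \<open>Suc\<close>.\<close>
proof (induction "\<Sum>t\<leftarrow>ts. Suc (2 * size t)" arbitrary: ts U x rule: less_induct)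
  case less
  show ?case
  proof (cases ts)
    case Nil
    then show ?thesis
      using less.prems by (intro lower_bound_le_0_linear[of U]) auto
  next
    case (Cons t ts')
    show ?thesis
    proof (cases t)
      case (Var v)
      show ?thesis
      proof (rule less.hyps[of ts' "insert v U"])
        fix l assume "l \<in> L"
        then show "(\<exists>u\<in>insert v U. l u \<le> 0) \<or> (\<exists>t\<in>set ts'. eval_term l t \<le> 0)"
          using less.prems(2)[of l] by (auto simp: Cons Var)
      next
        fix u assume "u \<in> insert v U"
        then show "x \<le> \<phi> u"
          using less.prems(4)[of t] less.prems(3)[of u] by (auto simp: Cons Var)
      qed (use less.prems in \<open>auto simp: Cons Var\<close>)
    next
      case (Sup a b)
      \<comment> \<open>Each argument of \<open>Sup\<close> replaces it in turn, with the bound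
        \<open>x\<close> lowered to stay below that argument. On reals the hypothesis survives
        because both arguments lie below their supremum.\<close>
      have branch: "inf (eval_term \<phi> c) x \<le> 0" if c: "c = a \<or> c = b" for c
      proof (rule less.hyps[of "c # ts'" U])
        show "(\<Sum>t\<leftarrow>c # ts'. Suc (2 * size t)) < (\<Sum>t\<leftarrow>ts. Suc (2 * size t))"
          using c by (auto simp: Cons Sup)
      next
        fix l assume "l \<in> L"
        then show "(\<exists>u\<in>U. l u \<le> 0) \<or> (\<exists>t\<in>set (c # ts'). eval_term l t \<le> 0)"
          using c less.prems(2)[of l] by (auto simp: Cons Sup)
      next
        fix u assume "u \<in> U"
        then show "inf (eval_term \<phi> c) x \<le> \<phi> u"
          by (intro le_infI2 less.prems(3))
      next
        fix t' assume "t' \<in> set (c # ts')"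
        then show "inf (eval_term \<phi> c) x \<le> eval_term \<phi> t'"
          using less.prems(4)[of t'] by (auto simp: Cons intro: le_infI2)
      qed (rule less.prems(1))
      have "x \<le> sup (eval_term \<phi> a) (eval_term \<phi> b)"
        using less.prems(4)[of t] Cons Sup by simp
      then show ?thesis
        by (rule le_0_if_inf_le_0) (simp_all add: branch)
    next
      case (Inf a b)
      show ?thesis
      proof (rule less.hyps[of "a # b # ts'" U])
        \<comment> \<open>Totality of the order on the reals enters here: a minimum is nonpositive
          only if one of its arguments is.\<close>
        fix l assume "l \<in> L"
        then show "(\<exists>u\<in>U. l u \<le> 0) \<or> (\<exists>t\<in>set (a # b # ts'). eval_term l t \<le> 0)"
          using less.prems(2)[of l] by (auto simp: Cons Inf inf_real_def min_le_iff_disj)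
      next
        fix t' assume "t' \<in> set (a # b # ts')"
        then show "x \<le> eval_term \<phi> t'"
          using less.prems(4)[of t] less.prems(4)[of t'] by (auto simp: Cons Inf)
      qed (use less.prems in \<open>auto simp: Cons Inf\<close>)
    qed
  qed
qed

end

end

section \<open>Freeness of the generated function lattice\<close>

lemma linear_evaluation:
  assumes "L \<subseteq> algebraic_dual"
  shows "linear (evaluation L)"
proof (rule linearI)
  have L: "linear l" if "l \<in> L" for l
    using that assms by (auto simp: algebraic_dual_def)
  show "evaluation L (x + y) = evaluation L x + evaluation L y" for x y
    using L by (auto simp: evaluation_def fun_eq_iff linear_add)
  show "evaluation L (r *\<^sub>R x) = r *\<^sub>R evaluation L x" for r x
    using L by (auto simp: evaluation_def fun_eq_iff linear_scale scaleR_fun_def)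
qed

text \<open>The difference of the two terms is again a term, and it vanishes at every functional in
  \<open>L\<close>. Its value under \<phi> is thus nonpositive, and exchanging the terms gives the
  reverse inequality.\<close>

lemma eval_term_eq_transfer:
  fixes \<phi> :: "'v::real_vector \<Rightarrow> 'a::vector_lattice"
  assumes L: "L \<subseteq> algebraic_dual" "subspace L" "separates_points L" and \<phi>: "linear \<phi>"
    and eq: "eval_term (evaluation L) s = eval_term (evaluation L) t"
  shows "eval_term \<phi> s = eval_term \<phi> t"
proof -
  have "eval_term \<phi> p - eval_term \<phi> q \<le> 0"
    if "eval_term (evaluation L) p = eval_term (evaluation L) q" for p q
  proof (rule lower_bound_le_0[OF \<phi> L, of "{}" "[add_term p (minus_term q)]"])
    fix l assume l: "l \<in> L"
    then have "linear l" using L(1) by (auto simp: algebraic_dual_def)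
    moreover have "eval_term l p = eval_term l q"
      using fun_cong[OF that, of l] l by (simp add: eval_term_apply evaluation_def)
    ultimately show "(\<exists>u\<in>{}. l u \<le> 0) \<or>
        (\<exists>t\<in>set [add_term p (minus_term q)]. eval_term l t \<le> 0)"
      by (simp add: eval_add_term eval_minus_term)
  qed (use \<phi> in \<open>simp_all add: eval_add_term eval_minus_term\<close>)
  from this[OF eq] this[OF eq[symmetric]] show ?thesis
    by (simp add: antisym)
qed

lemma vector_lattice_hom_eval_term:
  assumes "vector_lattice_hom (range (eval_term \<psi>)) G h"
  shows "h (eval_term \<psi> t) = eval_term (h \<circ> \<psi>) t"
  using assms by (induction t) (simp_all add: vector_lattice_hom_def)

lemma free_vector_lattice_evaluation:
  fixes L :: "('v::real_vector \<Rightarrow> real) set"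
  assumes L: "L \<subseteq> algebraic_dual" "subspace L" "separates_points L"
  shows "free_vector_lattice TYPE('g::vector_lattice) (evaluation L)
    (generated_vector_sublattice (range (evaluation L)))"
proof -
  let ?\<Psi> = "evaluation L"
  let ?F = "range (eval_term ?\<Psi>)"
  note lin = linear_evaluation[OF L(1)]
  have range_sub: "range ?\<Psi> \<subseteq> ?F"
    by (metis eval_term.simps(1) image_subsetI rangeI)
  have "\<exists>!h. vector_lattice_hom ?F G h \<and> h \<circ> ?\<Psi> = \<phi>"
    if G: "vector_sublattice G" and \<phi>: "linear \<phi>" "range \<phi> \<subseteq> G"
    for G :: "'g set" and \<phi>
  proof (rule ex1I)
    \<comment> \<open>The extension evaluates under \<phi> any term representing \<open>f\<close>;
      the transfer lemma makes the choice immaterial.\<close>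
    define h where "h = restrict (\<lambda>f. eval_term \<phi> (SOME t. eval_term ?\<Psi> t = f)) ?F"
    have h: "h (eval_term ?\<Psi> t) = eval_term \<phi> t" for t
    proof -
      have "eval_term ?\<Psi> (SOME s. eval_term ?\<Psi> s = eval_term ?\<Psi> t) = eval_term ?\<Psi> t"
        by (rule someI) simp
      from eval_term_eq_transfer[OF L \<phi>(1) this] show ?thesis
        by (simp add: h_def)
    qed
    have "eval_term \<phi> t \<in> G" for t
      using G \<phi>(2) by (induction t) (auto simp: vector_sublattice_def)
    then have "h \<in> ?F \<rightarrow>\<^sub>E G"
      using h by (auto simp: h_def)
    then have "vector_lattice_hom ?F G h"
      unfolding vector_lattice_hom_def
      \<comment> \<open>Sums, multiples, suprema and infima of values under \<open>?\<Psi>\<close>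
        are folded into the value of one term, so that \<open>h\<close> applies, and the result is
        unfolded again under \<phi>.\<close>
      by (auto simp: h eval_add_term[OF \<phi>(1)] eval_scale_term[OF \<phi>(1)]
          simp flip: eval_add_term[OF lin] eval_scale_term[OF lin] eval_term.simps(2,3))
    moreover have "h \<circ> ?\<Psi> = \<phi>"
      using h[of "Var _"] by auto
    ultimately show "vector_lattice_hom ?F G h \<and> h \<circ> ?\<Psi> = \<phi>" ..
    fix h' assume h': "vector_lattice_hom ?F G h' \<and> h' \<circ> ?\<Psi> = \<phi>"
    show "h' = h"
    proof (rule extensionalityI[of _ ?F])
      show "h' \<in> extensional ?F"
        using h' by (auto simp: vector_lattice_hom_def PiE_def)
      fix f assume "f \<in> ?F"
      then show "h' f = h f"
        using h' h vector_lattice_hom_eval_term by fastforce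
    qed (simp add: h_def)
  qed
  then show ?thesis
    unfolding free_vector_lattice_def generated_vector_sublattice_range[OF lin]
    using lin range_sub vector_sublattice_range_eval_term[OF lin] by simp
qed

section \<open>Uniqueness of free vector lattices\<close>

lemma vector_sublattice_Fun_on: "vector_sublattice (Fun_on X)"
  by (auto simp: vector_sublattice_def subspace_def Fun_on_def scaleR_fun_def)

lemma vector_lattice_hom_compose:
  assumes F: "vector_sublattice F" and g: "vector_lattice_hom F G g"
    and h: "vector_lattice_hom G H h"
  shows "vector_lattice_hom F H (compose F h g)"
proof -
  have "x + y \<in> F" "r *\<^sub>R x \<in> F" "sup x y \<in> F" "inf x y \<in> F" if "x \<in> F" "y \<in> F" for x y r
    using F that by (auto simp: vector_sublattice_def subspace_add subspace_scale)
  moreover have "g x \<in> G" if "x \<in> F" for x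
    using g that by (auto simp: vector_lattice_hom_def)
  ultimately show ?thesis
    using g h unfolding vector_lattice_hom_def by (auto simp: compose_def)
qed

lemma vector_lattice_hom_restrict_id:
  assumes "vector_sublattice F"
  shows "vector_lattice_hom F F (restrict id F)"
  using assms by (auto simp: vector_lattice_hom_def vector_sublattice_def subspace_add subspace_scale)

lemma free_vector_lattice_ex1:
  fixes G :: "'g::vector_lattice set"
  assumes "free_vector_lattice TYPE('g) j F"
    and "vector_sublattice G" "linear \<phi>" "range \<phi> \<subseteq> G"
  shows "\<exists>!h. vector_lattice_hom F G h \<and> h \<circ> j = \<phi>"
  using assms unfolding free_vector_lattice_def by blast

text \<open>Both \<open>h\<close> and the identity extend \<open>j\<close>. The identity has to be
  restricted to \<open>F\<close>, as homomorphisms are extensional.\<close>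

lemma free_vector_lattice_endomorphism:
  fixes F :: "'f::vector_lattice set"
  assumes free: "free_vector_lattice TYPE('f) j F"
    and h: "vector_lattice_hom F F h" "h \<circ> j = j" and "x \<in> F"
  shows "h x = x"
proof -
  have F: "vector_sublattice F" "linear j" "range j \<subseteq> F"
    using free by (auto simp: free_vector_lattice_def)
  have "restrict id F \<circ> j = j"
    using F(3) by (auto simp: fun_eq_iff)
  then have "h = restrict id F"
    using free_vector_lattice_ex1[OF free F] h vector_lattice_hom_restrict_id[OF F(1)] by blast
  then show ?thesis using \<open>x \<in> F\<close> by simp
qed

text \<open>Freeness of \<open>G\<close> at type \<open>'f\<close> provides the map back to
  \<open>F\<close>; freeness of each lattice at its own type makes the composite on it the
  identity.\<close>

lemma vector_lattice_iso_free:
  fixes F :: "'f::vector_lattice set" and G :: "'g::vector_lattice set"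
  assumes F: "free_vector_lattice TYPE('f) j F"
    and G: "free_vector_lattice TYPE('f) k G" "free_vector_lattice TYPE('g) k G"
    and h: "vector_lattice_hom F G h" "h \<circ> j = k"
  shows "vector_lattice_iso F G h"
proof -
  have subF: "vector_sublattice F" "linear j" "range j \<subseteq> F"
    and subG: "vector_sublattice G" "range k \<subseteq> G"
    using F G by (auto simp: free_vector_lattice_def)
  obtain g where g: "vector_lattice_hom G F g" "g \<circ> k = j"
    using free_vector_lattice_ex1[OF G(1) subF] by blast
  have gh: "g (h x) = x" if "x \<in> F" for x
  proof -
    have "compose F g h \<circ> j = j"
      using subF(3) g(2) h(2) by (auto simp: fun_eq_iff compose_def)
    then show ?thesis
      using free_vector_lattice_endomorphism[OF F vector_lattice_hom_compose[OF subF(1) h(1) g(1)]] that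
      by (simp add: compose_def)
  qed
  have hg: "h (g y) = y" if "y \<in> G" for y
  proof -
    have "compose G h g \<circ> k = k"
      using subG(2) g(2) h(2) by (auto simp: fun_eq_iff compose_def)
    then show ?thesis
      using free_vector_lattice_endomorphism[OF G(2) vector_lattice_hom_compose[OF subG(1) g(1) h(1)]] that
      by (simp add: compose_def)
  qed
  have "h \<in> F \<rightarrow> G" "g \<in> G \<rightarrow> F"
    using g(1) h(1) by (auto simp: vector_lattice_hom_def)
  then have "bij_betw h F G"
    using gh hg by (intro bij_betwI)
  then show ?thesis
    using h(1) by (simp add: vector_lattice_iso_def)
qed

section \<open>The isomorphism with the given free vector lattice\<close>

theorem theorem2p3:
  fixes j :: "'v::real_vector \<Rightarrow> 'f::vector_lattice"
    and F :: "'f set"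
    and L :: "('v \<Rightarrow> real) set"
    and \<Psi> :: "'v \<Rightarrow> ('v \<Rightarrow> real) \<Rightarrow> real"
    and \<Psi>bar :: "'f \<Rightarrow> ('v \<Rightarrow> real) \<Rightarrow> real"
    and \<F> :: "(('v \<Rightarrow> real) \<Rightarrow> real) set"
  assumes free_in_f: "free_vector_lattice TYPE('f) j F"
    and free_in_fun: "free_vector_lattice TYPE(('v \<Rightarrow> real) \<Rightarrow> real) j F"
    and L_dual: "L \<subseteq> algebraic_dual"
    and L_subspace: "subspace L"
    and L_separates: "separates_points L"
    and \<Psi>_eq: "\<Psi> = evaluation L"
    and \<Psi>bar_eq: "\<Psi>bar = hom_extension j F (Fun_on L) \<Psi>"
    and \<F>_eq: "\<F> = generated_vector_sublattice (range \<Psi>)"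
  shows "inj_on \<Psi>bar F \<and>
    vector_lattice_iso F \<F> \<Psi>bar \<and>
    free_vector_lattice TYPE('g::vector_lattice) \<Psi> \<F>"
proof -
  note L = L_dual L_subspace L_separates
  note free = free_vector_lattice_evaluation[OF L, folded \<Psi>_eq, folded \<F>_eq]
  have \<F>: "vector_sublattice \<F>" "linear \<Psi>" "range \<Psi> \<subseteq> \<F>"
    using free[where 'g = real] by (auto simp: free_vector_lattice_def)
  have Fun: "vector_sublattice (Fun_on L)" "range \<Psi> \<subseteq> Fun_on L"
    by (simp add: vector_sublattice_Fun_on) (auto simp: \<Psi>_eq Fun_on_def evaluation_def)
  have \<F>_sub: "\<F> \<subseteq> Fun_on L"
    unfolding \<F>_eq generated_vector_sublattice_def by (intro hull_minimal Fun)
  \<comment> \<open>Extending into \<F> instead of \<open>Fun_on L\<close> makes the uniqueness of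
    free objects applicable. Since \<F> lies in \<open>Fun_on L\<close>, this \<open>h\<close> also
    meets the description of \<Psi>bar and so equals it.\<close>
  obtain h where h: "vector_lattice_hom F \<F> h" "h \<circ> j = \<Psi>"
    using free_vector_lattice_ex1[OF free_in_fun \<F>] by blast
  have "vector_lattice_hom F (Fun_on L) h"
    using h(1) \<F>_sub by (auto simp: vector_lattice_hom_def)
  then have "\<Psi>bar = h"
    unfolding \<Psi>bar_eq hom_extension_def
    using the1_equality[OF free_vector_lattice_ex1[OF free_in_fun Fun(1) \<F>(2) Fun(2)]] h(2)
    by blast
  moreover have "vector_lattice_iso F \<F> h"
    by (rule vector_lattice_iso_free[OF free_in_f free free h])
  ultimately show ?thesis
    using free by (simp add: vector_lattice_iso_def bij_betw_def)
qed

end
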